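(* Let $S$ be a finite set of points in the plane, each colored red or blue. Then the minimum size of an SBCC of $S$ whose boxes are pairwise interior-disjoint is at most $9$ times the minimum size of an SBCC of $S$.
   Context: All boxes are closed, bounded, axis-aligned rectangles in the plane with non-empty interior. A box covers a point $p$ if $p$ lies in the interior of the box. An SBCC (simultaneous boxes class cover) of $S$ is a finite set of axis-aligned boxes such that every point of $S$ is covered by some box of the set, every box of the set covers only points of one color, and no box covering a red point intersects the interior of a box covering a blue point. Its size is its number of boxes. Boxes are interior-disjoint if their interiors are disjoint. *)

theory Defs
  imports "HOL-Analysis.Analysis"
begin

type_synonym point = "real \<times> real"

datatype color = Red | Blue

definition is_box :: "point set \<Rightarrow> bool" where
  "is_box Q \<longleftrightarrow> (\<exists>a b. Q = cbox a b) \<and> interior Q \<noteq> {}"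

definition covers :: "point set \<Rightarrow> point \<Rightarrow> bool" where
  "covers Q p \<longleftrightarrow> p \<in> interior Q"

definition SBCC :: "point set \<Rightarrow> (point \<Rightarrow> color) \<Rightarrow> point set set \<Rightarrow> bool" where
  "SBCC S col C \<longleftrightarrow>
     finite C \<and>
     (\<forall>Q\<in>C. is_box Q) \<and>
     (\<forall>p\<in>S. \<exists>Q\<in>C. covers Q p) \<and>
     (\<forall>Q\<in>C. \<forall>p\<in>S. \<forall>q\<in>S. covers Q p \<longrightarrow> covers Q q \<longrightarrow> col p = col q) \<and>
     (\<forall>Q\<in>C. \<forall>Q'\<in>C. \<forall>p\<in>S. \<forall>q\<in>S.
        col p = Red \<and> covers Q p \<and> col q = Blue \<and> covers Q' q \<longrightarrow> Q \<inter> interior Q' = {})"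

definition interior_disjoint :: "point set set \<Rightarrow> bool" where
  "interior_disjoint C \<longleftrightarrow> pairwise (\<lambda>Q Q'. interior Q \<inter> interior Q' = {}) C"

definition min_SBCC :: "point set \<Rightarrow> (point \<Rightarrow> color) \<Rightarrow> nat" where
  "min_SBCC S col = (LEAST k. \<exists>C. SBCC S col C \<and> card C = k)"

definition min_disjoint_SBCC :: "point set \<Rightarrow> (point \<Rightarrow> color) \<Rightarrow> nat" where
  "min_disjoint_SBCC S col = (LEAST k. \<exists>C. SBCC S col C \<and> interior_disjoint C \<and> card C = k)"

text \<open>For finite \<open>S\<close> both minima range over nonempty sets, so they are attained.\<close>

lemma disjoint_SBCC_exists:
  fixes S :: "point set"
  assumes "finite S"
  shows "\<exists>C. SBCC S col C \<and> interior_disjoint C"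
proof -
  have "\<forall>p. \<exists>d>0. \<forall>q\<in>S. q \<noteq> p \<longrightarrow> d \<le> dist p q"
    using finite_set_avoid[OF assms] by blast
  then obtain d where d: "\<And>p. d p > 0" "\<And>p q. q \<in> S \<Longrightarrow> q \<noteq> p \<Longrightarrow> d p \<le> dist p q"
    by metis
  have "\<exists>a b. p \<in> box a b \<and> cbox a b \<subseteq> ball p (d p / 2)" for p :: point
  proof -
    have "p \<in> ball p (d p / 2)" using d(1)[of p] by simp
    then show ?thesis using open_contains_cbox[OF open_ball] by metis
  qed
  then obtain a b where ab: "\<And>p. p \<in> box (a p) (b p)"
      "\<And>p. cbox (a p) (b p) \<subseteq> ball p (d p / 2)"
    by metis
  define Q where "Q p = cbox (a p) (b p)" for p
  have cov: "p \<in> interior (Q p)" for p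
    using ab(1) by (simp add: Q_def interior_cbox)
  have disj: "Q p \<inter> Q q = {}" if "p \<in> S" "q \<in> S" "p \<noteq> q" for p q
  proof (rule ccontr)
    assume "Q p \<inter> Q q \<noteq> {}"
    then obtain x where "x \<in> ball p (d p / 2)" "x \<in> ball q (d q / 2)"
      using ab(2) unfolding Q_def by blast
    then have "dist p q < d p / 2 + d q / 2"
      using dist_triangle2[of p q x] by auto
    moreover have "d p \<le> dist p q" "d q \<le> dist p q"
      using d(2)[of q p] d(2)[of p q] that by (auto simp: dist_commute)
    ultimately show False by linarith
  qed
  have own: "p = q" if "p \<in> S" "q \<in> S" "covers (Q p) q" for p q
    using disj[OF that(1,2)] that(3) cov[of q] interior_subset
    unfolding covers_def by blast
  have "SBCC S col (Q ` S)"
    unfolding SBCC_def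
  proof (intro conjI)
    show "\<forall>X\<in>Q ` S. is_box X"
      using cov unfolding is_box_def Q_def by blast
    show "\<forall>X\<in>Q ` S. \<forall>X'\<in>Q ` S. \<forall>p\<in>S. \<forall>q\<in>S.
        col p = Red \<and> covers X p \<and> col q = Blue \<and> covers X' q \<longrightarrow> X \<inter> interior X' = {}"
    proof (intro ballI impI, elim imageE conjE)
      fix X X' p q u v
      assume *: "p \<in> S" "q \<in> S" "col p = Red" "covers X p" "col q = Blue" "covers X' q"
        "X = Q u" "u \<in> S" "X' = Q v" "v \<in> S"
      then have "u = p" "v = q" using own by auto
      moreover have "p \<noteq> q" using * by auto
      ultimately show "X \<inter> interior X' = {}"
        using disj[of p q] * interior_subset[of X'] by blast
    qed
    show "finite (Q ` S)"
      using assms by simp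
    show "\<forall>p\<in>S. \<exists>X\<in>Q ` S. covers X p"
      using cov unfolding covers_def by blast
    show "\<forall>X\<in>Q ` S. \<forall>p\<in>S. \<forall>q\<in>S. covers X p \<longrightarrow> covers X q \<longrightarrow> col p = col q"
      using own by blast
  qed
  moreover have "interior_disjoint (Q ` S)"
    unfolding interior_disjoint_def pairwise_def
    using disj interior_subset by blast
  ultimately show ?thesis by blast
qed

end

theory Submission
  imports Defs
begin

text \<open>
  Shrink the boxes slightly so that no side is aligned with a point of \<open>S\<close>, and sweep the plane from
  left to right. Whenever a box starts, paint its \<open>y\<close>-range in its color from there on to the right
  without ever stopping, over whatever was painted before. A box that is still alive is never
  overpainted in the wrong color, because it does not meet the new one. Each start adds at most three
  rectangles: the new one and the remnants of the two old ones crossing its bottom and top line.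
  This yields the bound with \<open>3\<close> in place of \<open>9\<close>.
\<close>

section \<open>Open rectangles and shrinking into general position\<close>

type_synonym rectangle = "real \<times> real \<times> real \<times> real"

text \<open>The order is left, right, bottom, top. The set is open because covering refers to
  interiors, and degenerate tuples denote the empty set, so cutting needs no side
  conditions.\<close>

definition rect :: "rectangle \<Rightarrow> point set" where
  "rect = (\<lambda>(l, r, d, u). {l<..<r} \<times> {d<..<u})"

lemma mem_rect [simp]:
  "(x, y) \<in> rect (l, r, d, u) \<longleftrightarrow> l < x \<and> x < r \<and> d < y \<and> y < u"
  by (auto simp: rect_def)

lemma interior_cbox_rect: "interior (cbox (l, d) (r, u)) = rect (l, r, d, u)"
  for l d r u :: real
  by (simp add: cbox_Pair_eq interior_Times rect_def)

text \<open>A side moved inwards by less than the gap to the next coordinate of a point of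
  \<open>S\<close> loses no such point. The right side stays in place, since the sweep draws no line
  there.\<close>

lemma ex_rect_avoiding_coordinates:
  assumes "finite S" and "rect (l, r, d, u) \<inter> S \<noteq> {}"
  shows "\<exists>l' r' d' u'. rect (l', r', d', u') \<subseteq> rect (l, r, d, u) \<and>
    S \<inter> rect (l, r, d, u) \<subseteq> rect (l', r', d', u') \<and> l' < r' \<and> d' < u' \<and>
    (\<forall>(x, y)\<in>S. x \<noteq> l' \<and> y \<noteq> d' \<and> y \<noteq> u')"
proof -
  have above: "\<exists>e>t. e \<notin> X \<and> (\<forall>s\<in>X. t < s \<longrightarrow> e < s)" if "finite X" for t :: real and X
    using that
  proof induction
    case empty
    show ?case using gt_ex by auto
  next
    case (insert x X)
    then obtain e where e: "e > t" "e \<notin> X" "\<forall>s\<in>X. t < s \<longrightarrow> e < s" by blast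
    show ?case
    \<comment> \<open>Only a new value in the gap from \<open>t\<close> to \<open>e\<close> spoils
      the old choice; then anything strictly between \<open>t\<close> and \<open>x\<close>
      works.\<close>
    proof (cases "t < x \<and> x \<le> e")
      case True
      then obtain e' where e': "t < e'" "e' < x" using dense by blast
      with e True have "e' \<notin> X" "\<forall>s\<in>X. t < s \<longrightarrow> e' < s" by force+
      with e' show ?thesis by auto
    next
      case False
      with e show ?thesis by auto
    qed
  qed
  have below: "\<exists>e<t. e \<notin> X \<and> (\<forall>s\<in>X. s < t \<longrightarrow> s < e)" if fin: "finite X" for t :: real and X
  proof -
    obtain e where "e > - t" "e \<notin> uminus ` X" "\<forall>s\<in>uminus ` X. - t < s \<longrightarrow> e < s"
      using above[OF finite_imageI[OF fin, of uminus], of "- t"] by metis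
    then show ?thesis
      by (intro exI[of _ "- e"]) force
  qed
  obtain l' where l': "l' > l" "l' \<notin> fst ` S" "\<forall>s\<in>fst ` S. l < s \<longrightarrow> l' < s"
    using above[of "fst ` S" l] \<open>finite S\<close> by blast
  obtain d' where d': "d' > d" "d' \<notin> snd ` S" "\<forall>s\<in>snd ` S. d < s \<longrightarrow> d' < s"
    using above[of "snd ` S" d] \<open>finite S\<close> by blast
  obtain u' where u': "u' < u" "u' \<notin> snd ` S" "\<forall>s\<in>snd ` S. s < u \<longrightarrow> s < u'"
    using below[of "snd ` S" u] \<open>finite S\<close> by blast
  have sub: "S \<inter> rect (l, r, d, u) \<subseteq> rect (l', r, d', u')"
    using l' d' u' by force
  \<comment> \<open>The retained point of \<open>S\<close> witnesses that the sides have not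
    crossed.\<close>
  moreover have "rect (l', r, d', u') \<noteq> {}"
    using sub assms(2) by blast
  then have "l' < r \<and> d' < u'"
    by (auto simp: rect_def)
  moreover have "rect (l', r, d', u') \<subseteq> rect (l, r, d, u)"
    using l' d' u' by auto
  moreover have "\<forall>(x, y)\<in>S. x \<noteq> l' \<and> y \<noteq> d' \<and> y \<noteq> u'"
    using l' d' u' by force
  ultimately show ?thesis by blast
qed

section \<open>Painting a strip over a disjoint family\<close>

text \<open>Tagged rectangles are compared, so a nonempty rectangle cannot occur with two different
  colors.\<close>

definition rect_disjoint :: "(rectangle \<times> 'c) set \<Rightarrow> bool" where
  "rect_disjoint F \<longleftrightarrow> pairwise (\<lambda>T T'. rect (fst T) \<inter> rect (fst T') = {}) F"

lemma rect_disjointD: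
  assumes "rect_disjoint F" "T \<in> F" "T' \<in> F" "p \<in> rect (fst T)" "p \<in> rect (fst T')"
  shows "T = T'"
  using assms unfolding rect_disjoint_def pairwise_def by blast

text \<open>All left ends are at most \<open>a\<close>, so any two rectangles that reach beyond
  \<open>a\<close> and contain the height \<open>y\<close> share a point just to the right of
  \<open>a\<close>.\<close>

lemma card_crossing_le_1:
  assumes "finite F" "rect_disjoint F" "\<forall>((l, r, d, u), c)\<in>F. l \<le> a"
  shows "card {((l, r, d, u), c). ((l, r, d, u), c) \<in> F \<and> a < r \<and> d < y \<and> y < u} \<le> 1"
    (is "card ?X \<le> 1")
proof -
  have eq: "T = T'" if "T \<in> ?X" "T' \<in> ?X" for T T'
  proof -
    obtain l r d u c where T: "T = ((l, r, d, u), c)" by (metis prod.collapse)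
    obtain l' r' d' u' c' where T': "T' = ((l', r', d', u'), c')" by (metis prod.collapse)
    have in_F: "T \<in> F" "T' \<in> F" and *: "a < r" "d < y" "y < u" "a < r'" "d' < y" "y < u'"
      using that T T' by auto
    have "l \<le> a" "l' \<le> a" using assms(3) in_F T T' by auto
    moreover obtain x where "a < x" "x < min r r'" using dense[of a "min r r'"] * by auto
    ultimately have "(x, y) \<in> rect (fst T)" "(x, y) \<in> rect (fst T')"
      using * T T' by auto
    then show ?thesis using rect_disjointD[OF assms(2) in_F] by blast
  qed
  have "finite ?X" by (rule finite_subset[OF _ \<open>finite F\<close>]) auto
  then show ?thesis using eq by (metis (no_types, lifting) card_le_Suc0_iff_eq One_nat_def)
qed

text \<open>One event of the sweep: a strip starts at \<open>a\<close> and runs to \<open>M\<close>.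
  Old rectangles meeting its height range are truncated at \<open>a\<close>; beyond \<open>a\<close>
  only their parts below \<open>y1\<close> and above \<open>y2\<close> survive. Such parts come only
  from rectangles crossing one of these two lines, at most one per line, hence the 3. Points on the
  cutting lines are lost and therefore excluded.\<close>

lemma paint_step:
  fixes F :: "(rectangle \<times> 'c) set"
  assumes fin: "finite F" and disj: "rect_disjoint F"
    and left: "\<forall>((l, r, d, u), c)\<in>F. l \<le> a" and "y1 < y2"
  obtains G where "finite G" "card G \<le> card F + 3" "rect_disjoint G"
    "\<forall>((l, r, d, u), c)\<in>G. l \<le> a"
    "\<And>x y. a < x \<Longrightarrow> x < M \<Longrightarrow> y1 < y \<Longrightarrow> y < y2 \<Longrightarrow> \<exists>T\<in>G. (x, y) \<in> rect (fst T) \<and> snd T = c"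
    "\<And>x y T. T \<in> F \<Longrightarrow> (x, y) \<in> rect (fst T) \<Longrightarrow> x \<noteq> a \<Longrightarrow> y \<noteq> y1 \<Longrightarrow> y \<noteq> y2 \<Longrightarrow>
      x < a \<or> y < y1 \<or> y2 < y \<Longrightarrow> \<exists>T'\<in>G. (x, y) \<in> rect (fst T') \<and> snd T' = snd T"
proof -
  \<comment> \<open>Truncation may leave an empty rectangle, for instance if \<open>l = a\<close>.
    It stays in the family and is dropped only in \<open>SBCC_of_disjoint_rects\<close>.\<close>
  define cut :: "rectangle \<times> 'c \<Rightarrow> rectangle \<times> 'c"
    where "cut = (\<lambda>((l, r, d, u), c).
    if d < y2 \<and> y1 < u then ((l, min r a, d, u), c) else ((l, r, d, u), c))"
  define lo :: "rectangle \<times> 'c \<Rightarrow> rectangle \<times> 'c"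
    where "lo = (\<lambda>((l, r, d, u), c). ((a, r, d, y1), c))"
  define hi :: "rectangle \<times> 'c \<Rightarrow> rectangle \<times> 'c"
    where "hi = (\<lambda>((l, r, d, u), c). ((a, r, y2, u), c))"
  define L where "L = {((l, r, d, u), c). ((l, r, d, u), c) \<in> F \<and> a < r \<and> d < y1 \<and> y1 < u}"
  define H where "H = {((l, r, d, u), c). ((l, r, d, u), c) \<in> F \<and> a < r \<and> d < y2 \<and> y2 < u}"
  define G where "G = insert ((a, M, y1, y2), c) (cut ` F \<union> lo ` L \<union> hi ` H)"
  have LH: "L \<subseteq> F" "H \<subseteq> F" by (auto simp: L_def H_def)
  have finLH: "finite L" "finite H" using LH fin finite_subset by auto
  have cardLH: "card L \<le> 1" "card H \<le> 1"
    unfolding L_def H_def using card_crossing_le_1[OF fin disj left] by auto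
  have "finite G" using fin finLH by (simp add: G_def)
  moreover have "card G \<le> card F + 3"
  proof -
    have "card (cut ` F \<union> lo ` L \<union> hi ` H) \<le> card (cut ` F) + card (lo ` L) + card (hi ` H)"
      by (meson add_le_mono1 card_Un_le le_trans)
    also have "\<dots> \<le> card F + card L + card H"
      by (intro add_mono card_image_le fin finLH)
    finally show ?thesis
      using cardLH card_insert_le_m1[of "card F + 3" "cut ` F \<union> lo ` L \<union> hi ` H"]
      by (simp add: G_def)
  qed
  moreover have "rect_disjoint G"
    unfolding rect_disjoint_def pairwise_def
  proof (intro ballI impI, rule ccontr)
    fix A B assume AB: "A \<in> G" "B \<in> G" "A \<noteq> B" "rect (fst A) \<inter> rect (fst B) \<noteq> {}"
    then obtain x y where A: "(x, y) \<in> rect (fst A)" and B: "(x, y) \<in> rect (fst B)" by auto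
    \<comment> \<open>Each piece containing the common point is either the strip or stems from an
      old rectangle containing that point. The position of the point decides which; the clause on
      \<open>L\<close> and \<open>H\<close> keeps a truncated rectangle apart from its own remnants.
      As the old rectangle is unique, the two pieces coincide.\<close>
    have new_or_old: "Z = ((a, M, y1, y2), c) \<and> a < x \<and> y1 < y \<and> y < y2 \<or>
      (\<exists>T\<in>F. (x, y) \<in> rect (fst T) \<and>
        (Z = cut T \<and> (x < a \<or> y \<le> y1 \<or> y2 \<le> y) \<and> (x < a \<or> T \<notin> L \<and> T \<notin> H) \<or>
         Z = lo T \<and> T \<in> L \<and> a < x \<and> y < y1 \<or>
         Z = hi T \<and> T \<in> H \<and> a < x \<and> y2 < y))" (is "?P Z")
      if Z: "Z \<in> G" "(x, y) \<in> rect (fst Z)" for Z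
    proof -
      consider "Z = ((a, M, y1, y2), c)" | T where "T \<in> F" "Z = cut T"
        | T where "T \<in> L" "Z = lo T" | T where "T \<in> H" "Z = hi T"
        using Z(1) by (auto simp: G_def)
      then show ?thesis
      proof cases
        case 1
        with Z(2) show ?thesis by simp
      next
        case (2 T)
        obtain l r d u c' where T: "T = ((l, r, d, u), c')" by (metis prod.collapse)
        have "(x, y) \<in> rect (fst T) \<and> (x < a \<or> y \<le> y1 \<or> y2 \<le> y) \<and> (x < a \<or> T \<notin> L \<and> T \<notin> H)"
          using Z(2) \<open>y1 < y2\<close> 2 by (auto simp: T cut_def L_def H_def split: if_splits)
        with 2 show ?thesis by blast
      next
        case (3 T)
        obtain l r d u c' where T: "T = ((l, r, d, u), c')" by (metis prod.collapse)
        have "T \<in> F" using 3 LH by blast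
        moreover have "(x, y) \<in> rect (fst T) \<and> a < x \<and> y < y1"
          using Z(2) 3 left \<open>T \<in> F\<close> by (auto simp: T lo_def L_def)
        ultimately show ?thesis using 3 by blast
      next
        case (4 T)
        obtain l r d u c' where T: "T = ((l, r, d, u), c')" by (metis prod.collapse)
        have "T \<in> F" using 4 LH by blast
        moreover have "(x, y) \<in> rect (fst T) \<and> a < x \<and> y2 < y"
          using Z(2) 4 left \<open>T \<in> F\<close> by (auto simp: T hi_def H_def)
        ultimately show ?thesis using 4 by blast
      qed
    qed
    have same: "T = T'" if "T \<in> F" "T' \<in> F" "(x, y) \<in> rect (fst T)" "(x, y) \<in> rect (fst T')" for T T'
      using rect_disjointD[OF disj that] .
    have "?P A" "?P B" using new_or_old AB(1,2) A B by auto
    with same \<open>A \<noteq> B\<close> \<open>y1 < y2\<close> show False by (smt (verit))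
  qed
  moreover have "\<forall>((l, r, d, u), c)\<in>G. l \<le> a"
    using left by (auto simp: G_def cut_def lo_def hi_def split: if_splits)
  moreover have "\<exists>T\<in>G. (x, y) \<in> rect (fst T) \<and> snd T = c"
    if "a < x" "x < M" "y1 < y" "y < y2" for x y
    using that by (auto simp: G_def)
  moreover have "\<exists>T'\<in>G. (x, y) \<in> rect (fst T') \<and> snd T' = snd T"
    if T: "T \<in> F" "(x, y) \<in> rect (fst T)" and "x \<noteq> a" "y \<noteq> y1" "y \<noteq> y2"
      and out: "x < a \<or> y < y1 \<or> y2 < y" for x y T
  proof -
    obtain l r d u c' where Teq: "T = ((l, r, d, u), c')" by (metis prod.collapse)
    have xy: "l < x" "x < r" "d < y" "y < u" using T(2) Teq by auto
    \<comment> \<open>A rectangle that meets the height range of the strip and contains a point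
      below \<open>y1\<close> crosses the line at \<open>y1\<close>, so its lower remnant exists;
      likewise above \<open>y2\<close>.\<close>
    have "x < a \<or> \<not> (d < y2 \<and> y1 < u) \<or> a < x \<and> y < y1 \<and> y1 < u \<or> a < x \<and> y2 < y \<and> d < y2"
      using out \<open>x \<noteq> a\<close> xy \<open>y1 < y2\<close> by linarith
    then consider "x < a \<or> \<not> (d < y2 \<and> y1 < u)" | "a < x" "y < y1" "y1 < u" | "a < x" "y2 < y" "d < y2"
      by blast
    then show ?thesis
    proof cases
      case 1
      then have "(x, y) \<in> rect (fst (cut T)) \<and> snd (cut T) = snd T"
        using xy by (auto simp: Teq cut_def)
      then show ?thesis using T(1) by (auto simp: G_def)
    next
      case 2
      then have "T \<in> L" "(x, y) \<in> rect (fst (lo T)) \<and> snd (lo T) = snd T"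
        using xy T(1) by (auto simp: Teq lo_def L_def)
      then show ?thesis by (auto simp: G_def)
    next
      case 3
      then have "T \<in> H" "(x, y) \<in> rect (fst (hi T)) \<and> snd (hi T) = snd T"
        using xy T(1) by (auto simp: Teq hi_def H_def)
      then show ?thesis by (auto simp: G_def)
    qed
  qed
  ultimately show thesis by (rule that)
qed

section \<open>The sweep over all boxes\<close>

text \<open>Boxes are inserted in order of their left ends, each by one \<open>paint_step\<close>.
  The clause on left ends is carried along as an invariant: it places all earlier pieces' left ends
  at or before the start of the new box.\<close>

lemma ex_disjoint_rects:
  fixes D :: "(rectangle \<times> 'c) set"
  assumes "finite D"
    and "\<forall>(x, y)\<in>S. x < M"
    and "\<forall>((l, r, d, u), c)\<in>D. l < r \<and> d < u \<and> (\<forall>(x, y)\<in>S. x \<noteq> l \<and> y \<noteq> d \<and> y \<noteq> u)"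
    and "\<forall>R\<in>D. \<forall>R'\<in>D. snd R \<noteq> snd R' \<longrightarrow> rect (fst R) \<inter> rect (fst R') = {}"
  shows "\<exists>F. finite F \<and> rect_disjoint F \<and> card F \<le> 3 * card D \<and>
    (\<forall>((l, r, d, u), c)\<in>F. \<exists>R\<in>D. l \<le> fst (fst R)) \<and>
    (\<forall>R\<in>D. \<forall>p\<in>S \<inter> rect (fst R). \<exists>T\<in>F. p \<in> rect (fst T) \<and> snd T = snd R)"
  using assms(1,3,4)
proof (induction D rule: finite_ranking_induct[where f = "\<lambda>R. fst (fst R)"])
  case empty
  show ?case by (rule exI[of _ "{}"]) (simp add: rect_disjoint_def)
next
  case (insert R D)
  show ?case
  \<comment> \<open>The ranking induction may insert an element already present; counting 3 per box
    needs a new one.\<close>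
  proof (cases "R \<in> D")
    case True
    with insert show ?thesis by (simp add: insert_absorb)
  next
    case False
    obtain a b y1 y2 c where R: "R = ((a, b, y1, y2), c)" by (metis prod.collapse)
    have gp: "a < b" "y1 < y2" "\<And>x y. (x, y) \<in> S \<Longrightarrow> x \<noteq> a \<and> y \<noteq> y1 \<and> y \<noteq> y2"
      using insert.prems(1) R by auto
    obtain F where F: "finite F" "rect_disjoint F" "card F \<le> 3 * card D"
      "\<forall>((l, r, d, u), c)\<in>F. \<exists>R\<in>D. l \<le> fst (fst R)"
      "\<forall>R\<in>D. \<forall>p\<in>S \<inter> rect (fst R). \<exists>T\<in>F. p \<in> rect (fst T) \<and> snd T = snd R"
    proof -
      have "\<forall>((l, r, d, u), c)\<in>D. l < r \<and> d < u \<and> (\<forall>(x, y)\<in>S. x \<noteq> l \<and> y \<noteq> d \<and> y \<noteq> u)"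
        and "\<forall>R\<in>D. \<forall>R'\<in>D. snd R \<noteq> snd R' \<longrightarrow> rect (fst R) \<inter> rect (fst R') = {}"
        using insert.prems by simp_all
      from insert.IH[OF this] show ?thesis
        by (elim exE conjE) (rule that)
    qed
    have left_D: "fst (fst R') \<le> a" if "R' \<in> D" for R'
      using insert.hyps that R by fastforce
    then have left: "\<forall>((l, r, d, u), c)\<in>F. l \<le> a"
      using F(4) by fastforce
    obtain G where G: "finite G" "card G \<le> card F + 3" "rect_disjoint G"
      "\<forall>((l, r, d, u), c)\<in>G. l \<le> a"
      "\<And>x y. a < x \<Longrightarrow> x < M \<Longrightarrow> y1 < y \<Longrightarrow> y < y2 \<Longrightarrow> \<exists>T\<in>G. (x, y) \<in> rect (fst T) \<and> snd T = c"
      "\<And>x y T. T \<in> F \<Longrightarrow> (x, y) \<in> rect (fst T) \<Longrightarrow> x \<noteq> a \<Longrightarrow> y \<noteq> y1 \<Longrightarrow> y \<noteq> y2 \<Longrightarrow>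
        x < a \<or> y < y1 \<or> y2 < y \<Longrightarrow> \<exists>T'\<in>G. (x, y) \<in> rect (fst T') \<and> snd T' = snd T"
      by (rule paint_step[OF F(1,2) left gp(2), of M c]) (rule that)
    have "card G \<le> 3 * card (insert R D)"
      using G(2) F(3) False insert.hyps by simp
    moreover have "\<exists>T\<in>G. p \<in> rect (fst T) \<and> snd T = snd R'"
      if R': "R' \<in> insert R D" and p: "p \<in> S" "p \<in> rect (fst R')" for R' p
    proof -
      obtain x y where xy: "p = (x, y)" by fastforce
      have ne: "x \<noteq> a" "y \<noteq> y1" "y \<noteq> y2" "x < M" using gp(3) p(1) xy assms(2) by auto
      show ?thesis
      proof (cases "R' = R")
        case True
        then show ?thesis using G(5)[of x y] p ne by (auto simp: xy R)
      next
        case False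
        then have "R' \<in> D" using R' by simp
        then obtain T where T: "T \<in> F" "p \<in> rect (fst T)" "snd T = snd R'" using F(5) p by blast
        show ?thesis
        proof (cases "x < a \<or> y < y1 \<or> y2 < y")
          case True
          then show ?thesis using G(6)[of T x y] T ne by (auto simp: xy)
        next
          case False
          \<comment> \<open>The strip overpaints a point of the older box \<open>R'\<close>,
            possibly beyond the right end \<open>b\<close> of \<open>R\<close>. But
            \<open>R'\<close> starts no later than \<open>a\<close> and reaches past it at height
            \<open>y\<close>, so it meets \<open>R\<close> just to the right of \<open>a\<close>.
            Hence both have the same color and the overpainting is harmless.\<close>
          then have in_new: "a < x" "y1 < y" "y < y2" using ne by auto
          obtain l r d u c' where R'eq: "R' = ((l, r, d, u), c')" by (metis prod.collapse)
          obtain z where "a < z" "z < min x b" using dense[of a "min x b"] in_new gp(1) by auto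
          then have "(z, y) \<in> rect (fst R') \<inter> rect (fst R)"
            using left_D[OF \<open>R' \<in> D\<close>] p(2) in_new by (auto simp: R'eq R xy)
          then have "snd R' = c" using insert.prems(2) R' R by fastforce
          then show ?thesis using G(5)[OF in_new(1) ne(4) in_new(2,3)] xy by simp
        qed
      qed
    qed
    moreover have "\<forall>((l, r, d, u), c)\<in>G. \<exists>R\<in>insert R D. l \<le> fst (fst R)"
      using G(4) R by fastforce
    ultimately show ?thesis using G(1,3) by blast
  qed
qed

section \<open>From tagged rectangles back to an SBCC\<close>

text \<open>By disjointness, the only rectangle containing a point of \<open>S\<close> is the one
  tagged with its color, so each tag is the color of all points of \<open>S\<close> inside.\<close>

lemma SBCC_of_disjoint_rects:
  assumes fin: "finite F" and disj: "rect_disjoint F"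
    and cov: "\<And>p. p \<in> S \<Longrightarrow> \<exists>T\<in>F. p \<in> rect (fst T) \<and> snd T = col p"
  shows "\<exists>C. SBCC S col C \<and> interior_disjoint C \<and> card C \<le> card F"
proof -
  define bx :: "rectangle \<times> color \<Rightarrow> point set"
    where "bx = (\<lambda>((l, r, d, u), c). cbox (l, d) (r, u))"
  have int_bx: "interior (bx T) = rect (fst T)" for T
    by (simp add: bx_def interior_cbox_rect del: interior_cbox split: prod.split)
  \<comment> \<open>Every rectangle kept contains a point of \<open>S\<close>, so its closed version
    has nonempty interior, as a box must.\<close>
  define F' where "F' = {T \<in> F. rect (fst T) \<inter> S \<noteq> {}}"
  have F': "finite F'" "F' \<subseteq> F" using fin by (auto simp: F'_def)
  have is_bx: "is_box (bx T)" if "T \<in> F'" for T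
  proof -
    have "interior (bx T) \<noteq> {}" using that by (auto simp: F'_def int_bx)
    then show ?thesis by (cases T) (auto simp: is_box_def bx_def)
  qed
  have tag: "snd T = col p" if "T \<in> F'" "p \<in> S" "covers (bx T) p" for T p
    using cov[OF that(2)] rect_disjointD[OF disj] that F' by (metis covers_def int_bx subsetD)
  have dis: "bx T \<inter> interior (bx T') = {}" if neq: "T \<in> F'" "T' \<in> F'" "T \<noteq> T'" for T T'
  proof -
    have "interior (bx T') \<inter> interior (bx T) = {}"
      using rect_disjointD[OF disj] neq F' by (fastforce simp: int_bx)
    \<comment> \<open>An SBCC demands that a whole closed box avoid the other interior. An open set
      disjoint from a set is disjoint from its closure, and a nondegenerate box is the closure of
      its interior.\<close>
    then have "interior (bx T') \<inter> closure (interior (bx T)) = {}"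
      by (simp add: open_Int_closure_eq_empty)
    moreover obtain a b where "bx T = cbox a b" "box a b \<noteq> {}"
      using is_bx[OF neq(1)] unfolding is_box_def by (metis interior_cbox)
    then have "closure (interior (bx T)) = bx T"
      by (simp only: interior_cbox closure_box simp_thms)
    ultimately show ?thesis by (metis Int_commute)
  qed
  have "SBCC S col (bx ` F')"
    unfolding SBCC_def
  proof (intro conjI)
    show "finite (bx ` F')" using F' by simp
    show "\<forall>Q\<in>bx ` F'. is_box Q" using is_bx by blast
    show "\<forall>p\<in>S. \<exists>Q\<in>bx ` F'. covers Q p"
    proof
      fix p assume "p \<in> S"
      with cov obtain T where "T \<in> F" "p \<in> rect (fst T)" by blast
      with \<open>p \<in> S\<close> have "T \<in> F'" "covers (bx T) p" by (auto simp: F'_def covers_def int_bx)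
      then show "\<exists>Q\<in>bx ` F'. covers Q p" by blast
    qed
    show "\<forall>Q\<in>bx ` F'. \<forall>p\<in>S. \<forall>q\<in>S. covers Q p \<longrightarrow> covers Q q \<longrightarrow> col p = col q"
      using tag by fastforce
    show "\<forall>Q\<in>bx ` F'. \<forall>Q'\<in>bx ` F'. \<forall>p\<in>S. \<forall>q\<in>S.
        col p = Red \<and> covers Q p \<and> col q = Blue \<and> covers Q' q \<longrightarrow> Q \<inter> interior Q' = {}"
    proof (intro ballI impI, elim imageE conjE)
      fix Q Q' p q T T'
      assume *: "p \<in> S" "q \<in> S" "col p = Red" "covers Q p" "col q = Blue" "covers Q' q"
        "Q = bx T" "T \<in> F'" "Q' = bx T'" "T' \<in> F'"
      then have "snd T = Red" "snd T' = Blue" using tag by auto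
      then show "Q \<inter> interior Q' = {}" using dis[of T T'] * by (metis color.distinct(1))
    qed
  qed
  moreover have "interior_disjoint (bx ` F')"
    unfolding interior_disjoint_def pairwise_def
    using dis interior_subset by blast
  moreover have "card (bx ` F') \<le> card F"
    using F' fin by (meson card_image_le card_mono le_trans)
  ultimately show ?thesis by blast
qed

text \<open>The given boxes are shrunk into general position, tagged with the color of their points,
  and passed to the sweep.\<close>

lemma ex_disjoint_SBCC_card_le:
  assumes "finite S" and C: "SBCC S col C"
  shows "\<exists>C'. SBCC S col C' \<and> interior_disjoint C' \<and> card C' \<le> 3 * card C"
proof -
  \<comment> \<open>A box covering no point of \<open>S\<close> has no color, so nothing would
    separate it from the others; it is discarded.\<close>
  define E where "E = {Q \<in> C. \<exists>p\<in>S. covers Q p}"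
  have "finite C" using C by (simp add: SBCC_def)
  then have E: "finite E" "card E \<le> card C" by (auto simp: E_def intro: card_mono)
  define good where "good Q R \<longleftrightarrow> rect (fst R) \<subseteq> interior Q \<and> S \<inter> interior Q \<subseteq> rect (fst R) \<and>
      (\<exists>p\<in>S. covers Q p \<and> col p = snd R) \<and>
      (\<lambda>((l, r, d, u), c). l < r \<and> d < u \<and> (\<forall>(x, y)\<in>S. x \<noteq> l \<and> y \<noteq> d \<and> y \<noteq> u)) R"
    for Q and R :: "rectangle \<times> color"
  have "\<exists>R. good Q R" if "Q \<in> E" for Q
  proof -
    obtain p where p: "p \<in> S" "covers Q p" using \<open>Q \<in> E\<close> unfolding E_def by blast
    obtain l d r u where Q: "Q = cbox (l, d) (r, u)"
      using C \<open>Q \<in> E\<close> unfolding SBCC_def E_def is_box_def by (metis (no_types, lifting) mem_Collect_eq surj_pair)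
    obtain l' r' d' u' where "rect (l', r', d', u') \<subseteq> interior Q"
      "S \<inter> interior Q \<subseteq> rect (l', r', d', u')" "l' < r'" "d' < u'"
      "\<forall>(x, y)\<in>S. x \<noteq> l' \<and> y \<noteq> d' \<and> y \<noteq> u'"
      using ex_rect_avoiding_coordinates[OF \<open>finite S\<close>, of l r d u] p unfolding Q covers_def interior_cbox_rect by blast
    then have "good Q ((l', r', d', u'), col p)" using p by (auto simp: good_def)
    then show ?thesis by blast
  qed
  then obtain R where good: "\<And>Q. Q \<in> E \<Longrightarrow> good Q (R Q)" by metis
  note good' = good[unfolded good_def]
  note R = good'[THEN conjunct1] good'[THEN conjunct2, THEN conjunct1]
    good'[THEN conjunct2, THEN conjunct2, THEN conjunct1]
    good'[THEN conjunct2, THEN conjunct2, THEN conjunct2]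
  have sep: "interior Q \<inter> interior Q' = {}" if "Q \<in> E" "Q' \<in> E" "snd (R Q) \<noteq> snd (R Q')" for Q Q'
  proof -
    have *: "Q \<inter> interior Q' = {}"
      if cols: "Q \<in> E" "Q' \<in> E" "snd (R Q) = Red" "snd (R Q') = Blue" for Q Q'
    proof -
      obtain p q where "p \<in> S" "covers Q p" "col p = Red" "q \<in> S" "covers Q' q" "col q = Blue"
        using R(3)[OF cols(1)] R(3)[OF cols(2)] cols by auto
      moreover have "Q \<in> C" "Q' \<in> C" using cols by (simp_all add: E_def)
      moreover have "\<forall>Q\<in>C. \<forall>Q'\<in>C. \<forall>p\<in>S. \<forall>q\<in>S.
          col p = Red \<and> covers Q p \<and> col q = Blue \<and> covers Q' q \<longrightarrow> Q \<inter> interior Q' = {}"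
        using C unfolding SBCC_def by (elim conjE)
      ultimately show ?thesis by blast
    qed
    have "snd (R Q) = Red \<and> snd (R Q') = Blue \<or> snd (R Q') = Red \<and> snd (R Q) = Blue"
      using that(3) by (cases "snd (R Q)"; cases "snd (R Q')"; simp)
    then show ?thesis using * that interior_subset by blast
  qed
  have fin_D: "finite (R ` E)" using E by simp
  \<comment> \<open>Beyond all points of \<open>S\<close>, so strips ending here cover every point
    to their right as if unbounded. For empty \<open>S\<close> the value of \<open>Max\<close> is
    arbitrary, and the bound holds vacuously.\<close>
  define M where "M = Max (fst ` S) + 1"
  have "x < M" if "(x, y) \<in> S" for x y
  proof -
    have "x \<in> fst ` S" using that by force
    then have "x \<le> Max (fst ` S)" using \<open>finite S\<close> by simp
    then show ?thesis by (simp add: M_def)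
  qed
  then have M: "\<forall>(x, y)\<in>S. x < M" by blast
  have gp: "\<forall>((l, r, d, u), c)\<in>R ` E. l < r \<and> d < u \<and> (\<forall>(x, y)\<in>S. x \<noteq> l \<and> y \<noteq> d \<and> y \<noteq> u)"
    by (intro ballI, elim imageE, hypsubst) (rule R(4))
  have colors_disjoint: "\<forall>T\<in>R ` E. \<forall>T'\<in>R ` E. snd T \<noteq> snd T' \<longrightarrow> rect (fst T) \<inter> rect (fst T') = {}"
  proof (intro ballI impI, elim imageE)
    fix T T' Q Q'
    assume *: "snd T \<noteq> snd T'" "T = R Q" "Q \<in> E" "T' = R Q'" "Q' \<in> E"
    then have "interior Q \<inter> interior Q' = {}" using sep by simp
    then show "rect (fst T) \<inter> rect (fst T') = {}" using R(1) * by blast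
  qed
  obtain F where F: "finite F" "rect_disjoint F" "card F \<le> 3 * card (R ` E)"
    "\<forall>R\<in>R ` E. \<forall>p\<in>S \<inter> rect (fst R). \<exists>T\<in>F. p \<in> rect (fst T) \<and> snd T = snd R"
    using ex_disjoint_rects[OF fin_D M gp colors_disjoint] by (elim exE conjE) (rule that)
  have "\<exists>T\<in>F. p \<in> rect (fst T) \<and> snd T = col p" if "p \<in> S" for p
  proof -
    obtain Q where Q: "Q \<in> E" "covers Q p" using C \<open>p \<in> S\<close> unfolding SBCC_def E_def by blast
    obtain q where q: "q \<in> S" "covers Q q" "col q = snd (R Q)" using R(3)[OF Q(1)] by blast
    have "\<forall>Q\<in>C. \<forall>p\<in>S. \<forall>q\<in>S. covers Q p \<longrightarrow> covers Q q \<longrightarrow> col p = col q"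
      using C unfolding SBCC_def by (elim conjE)
    with q Q \<open>p \<in> S\<close> have "col p = snd (R Q)" unfolding E_def by (metis (lifting) mem_Collect_eq)
    moreover have "p \<in> rect (fst (R Q))" using R(2) Q \<open>p \<in> S\<close> by (auto simp: covers_def)
    ultimately show ?thesis using F(4) Q \<open>p \<in> S\<close> by auto
  qed
  then obtain C' where "SBCC S col C'" "interior_disjoint C'" "card C' \<le> card F"
    using SBCC_of_disjoint_rects[OF F(1,2)] by blast
  moreover have "card F \<le> 3 * card C"
    using F(3) E card_image_le[of E R] by linarith
  ultimately show ?thesis using le_trans by blast
qed

theorem theorem20:
  fixes S :: "point set" and col :: "point \<Rightarrow> color"
  assumes "finite S"
  shows "min_disjoint_SBCC S col \<le> 9 * min_SBCC S col"
proof -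
  have "\<exists>k C. SBCC S col C \<and> card C = k"
    using disjoint_SBCC_exists[OF assms] by blast
  \<comment> \<open>Existence of some SBCC makes the \<open>LEAST\<close> an attained value.\<close>
  from LeastI_ex[OF this] obtain C where C: "SBCC S col C" "card C = min_SBCC S col"
    unfolding min_SBCC_def by blast
  then obtain C' where C': "SBCC S col C'" "interior_disjoint C'" "card C' \<le> 3 * card C"
    using ex_disjoint_SBCC_card_le[OF assms] by blast
  have "min_disjoint_SBCC S col \<le> card C'"
    unfolding min_disjoint_SBCC_def using C' by (intro Least_le) blast
  also have "\<dots> \<le> 9 * min_SBCC S col"
    using C' C by simp
  finally show ?thesis .
qed

end
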